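(* Let ${\tt f}$ be the Fibonacci word and let ${\tt w}=D({\tt f})$ be the Fibonacci word with its initial ${\tt a}{\tt b}$ deleted. Then $r_{\tt w}(n)=n+1$ for all $n\geqslant1$.
   Context: The Fibonacci word ${\tt f}={\tt a}{\tt b}{\tt a}{\tt a}{\tt b}{\tt a}{\tt b}{\tt a}\cdots$ is the fixed point of $\varrho_F:{\tt a}\mapsto{\tt a}{\tt b},\ {\tt b}\mapsto{\tt a}$. For a word in which both letters occur infinitely often, $D$ deletes the first occurrence of ${\tt a}$ and the first occurrence of ${\tt b}$. Words are indexed from position $0$; $p_{\tt a}(n)$, $p_{\tt b}(n)$ denote the positions of the $n$-th ${\tt a}$ and $n$-th ${\tt b}$, and $r_{\tt w}(n)=p_{\tt b}(n)-p_{\tt a}(n)$. *)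

theory Defs
  imports Complex_Main "HOL-Library.Stream" "HOL-Library.Infinite_Set"
begin

datatype letter = A | B

fun fib_subst :: "letter \<Rightarrow> letter list" where
  "fib_subst A = [A, B]"
| "fib_subst B = [A]"

definition subst_word :: "('a \<Rightarrow> 'a list) \<Rightarrow> 'a stream \<Rightarrow> 'a stream" where
  "subst_word \<rho> w = flat (smap \<rho> w)"

definition fib_word :: "letter stream" where
  "fib_word = (THE f. subst_word fib_subst f = f)"

definition del_first :: "'a \<Rightarrow> 'a stream \<Rightarrow> 'a stream" where
  "del_first x w = (let i = (LEAST i. w !! i = x) in stake i w @- sdrop (Suc i) w)"

text \<open>Deleting the first \<^const>\<open>A\<close> does not affect which occurrence of \<^const>\<open>B\<close> is the first,
  so the two deletions may be performed one after the other.\<close>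

definition del_AB :: "letter stream \<Rightarrow> letter stream" where
  "del_AB w = del_first B (del_first A w)"

text \<open>Positions start at 0, but occurrences are counted from 1: \<open>pos x w n\<close> is meant for
  \<open>n \<ge> 1\<close> and for words in which \<open>x\<close> occurs infinitely often.\<close>

definition pos :: "'a \<Rightarrow> 'a stream \<Rightarrow> nat \<Rightarrow> nat" where
  "pos x w n = enumerate {i. w !! i = x} (n - 1)"

definition pos_diff :: "letter stream \<Rightarrow> nat \<Rightarrow> int" where
  "pos_diff w n = int (pos B w n) - int (pos A w n)"


text \<open>The definitions above are meaningful for the Fibonacci word: the fixed point exists and is
  unique, both letters occur infinitely often (also after the deletion), and the deleted letters are
  the initial two.\<close>

definition fib_prefix :: "nat \<Rightarrow> letter list" where
  "fib_prefix n = ((\<lambda>xs. concat (map fib_subst xs)) ^^ n) [A]"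

lemma fib_prefix_0: "fib_prefix 0 = [A]"
  by (simp add: fib_prefix_def)

lemma fib_prefix_Suc: "fib_prefix (Suc n) = concat (map fib_subst (fib_prefix n))"
  by (simp add: fib_prefix_def)

lemma fib_prefix_rec: "fib_prefix (Suc (Suc n)) = fib_prefix (Suc n) @ fib_prefix n"
proof (induction n)
  case 0
  show ?case by (simp add: fib_prefix_Suc fib_prefix_0)
next
  case (Suc n)
  then show ?case
    by (metis fib_prefix_Suc map_append concat_append)
qed

lemma fib_prefix_ne: "fib_prefix n \<noteq> []"
proof (induction n)
  case (Suc n)
  obtain x xs where "fib_prefix n = x # xs" using Suc by (cases "fib_prefix n") auto
  then show ?case by (cases x) (auto simp: fib_prefix_Suc)
qed (simp add: fib_prefix_0)

lemma fib_prefix_step: "\<exists>zs. fib_prefix (Suc n) = fib_prefix n @ zs"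
proof (cases n)
  case 0
  then show ?thesis by (simp add: fib_prefix_Suc fib_prefix_0)
next
  case (Suc m)
  then show ?thesis using fib_prefix_rec[of m] by blast
qed

lemma fib_prefix_mono: "m \<le> n \<Longrightarrow> \<exists>zs. fib_prefix n = fib_prefix m @ zs"
proof (induction n rule: dec_induct)
  case (step n)
  then show ?case using fib_prefix_step[of n] by auto
qed auto

lemma fib_prefix_length: "n < length (fib_prefix n)"
proof (induction n rule: less_induct)
  case (less n)
  show ?case
  proof (cases n)
    case 0
    then show ?thesis by (simp add: fib_prefix_0)
  next
    case (Suc m)
    show ?thesis
    proof (cases m)
      case 0
      then show ?thesis using Suc by (simp add: fib_prefix_Suc fib_prefix_0)
    next
      case (Suc k)
      have "0 < length (fib_prefix k)" using fib_prefix_ne by simp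
      moreover have "Suc k < length (fib_prefix (Suc k))"
        using less \<open>n = Suc m\<close> Suc by simp
      ultimately have "Suc (Suc k) < length (fib_prefix (Suc k)) + length (fib_prefix k)"
        by linarith
      then show ?thesis using \<open>n = Suc m\<close> Suc by (simp add: fib_prefix_rec)
    qed
  qed
qed

lemma subst_word_fib_shift:
  "subst_word fib_subst (xs @- s) = concat (map fib_subst xs) @- subst_word fib_subst s"
proof (induction xs)
  case (Cons x xs)
  then show ?case by (cases x) (simp_all add: subst_word_def)
qed simp

lemma stream_eq_fib_prefixes:
  assumes "\<And>n. \<exists>t. s = fib_prefix n @- t" and "\<And>n. \<exists>t. s' = fib_prefix n @- t"
  shows "s = s'"
proof -
  have "s !! n = s' !! n" for n
  proof -
    obtain t t' where "s = fib_prefix n @- t" "s' = fib_prefix n @- t'" using assms by blast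
    then show ?thesis using fib_prefix_length[of n] by (simp add: shift_snth_less)
  qed
  then show ?thesis by (metis ext stream_smap_nats)
qed

lemma fixed_point_fib_prefix:
  assumes "subst_word fib_subst s = s"
  shows "\<exists>t. s = fib_prefix n @- t"
proof (induction n)
  case 0
  have "shd s = A"
  proof -
    have "shd (subst_word fib_subst s) = hd (fib_subst (shd s))"
      by (simp add: subst_word_def)
    then show ?thesis using assms by (cases "shd s") auto
  qed
  then have "s = fib_prefix 0 @- stl s" by (cases s) (auto simp: fib_prefix_0)
  then show ?case ..
next
  case (Suc n)
  then obtain t where "s = fib_prefix n @- t" ..
  then have "subst_word fib_subst s = fib_prefix (Suc n) @- subst_word fib_subst t"
    by (simp add: subst_word_fib_shift fib_prefix_Suc)
  then show ?case using assms by metis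
qed

lemma fixed_point_exists: "\<exists>s. subst_word fib_subst s = s"
proof -
  define s where "s = smap (\<lambda>n. fib_prefix n ! n) nats"
  have nth: "fib_prefix n ! i = s !! i" if "i < length (fib_prefix n)" for n i
  proof (cases "i \<le> n")
    case True
    then obtain zs where "fib_prefix n = fib_prefix i @ zs" using fib_prefix_mono by blast
    then show ?thesis using fib_prefix_length[of i] by (simp add: s_def nth_append)
  next
    case False
    then obtain zs where "fib_prefix i = fib_prefix n @ zs" using fib_prefix_mono[of n i] by auto
    then show ?thesis using that by (simp add: s_def nth_append)
  qed
  have pre: "\<exists>t. s = fib_prefix n @- t" for n
  proof
    have "stake (length (fib_prefix n)) s = fib_prefix n"
      by (rule nth_equalityI) (simp_all add: nth)
    then show "s = fib_prefix n @- sdrop (length (fib_prefix n)) s" by (metis stake_sdrop)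
  qed
  have "\<exists>t. subst_word fib_subst s = fib_prefix n @- t" for n
  proof -
    obtain t where "s = fib_prefix n @- t" using pre by blast
    moreover obtain zs where "fib_prefix (Suc n) = fib_prefix n @ zs"
      using fib_prefix_step by blast
    ultimately have "subst_word fib_subst s = fib_prefix n @- (zs @- subst_word fib_subst t)"
      by (simp add: subst_word_fib_shift flip: fib_prefix_Suc)
    then show ?thesis ..
  qed
  then have "subst_word fib_subst s = s" using pre by (rule stream_eq_fib_prefixes)
  then show ?thesis ..
qed

lemma fib_word_ex1: "\<exists>!f. subst_word fib_subst f = f"
  using fixed_point_exists fixed_point_fib_prefix stream_eq_fib_prefixes by metis

lemma fib_word_fixed: "subst_word fib_subst fib_word = fib_word"
  unfolding fib_word_def by (rule theI'[OF fib_word_ex1])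

lemma fib_word_prefix: "\<exists>t. fib_word = fib_prefix n @- t"
  by (rule fixed_point_fib_prefix[OF fib_word_fixed])

lemma fib_prefix_letters: "x \<in> set (fib_prefix (Suc n))"
proof -
  obtain zs where "fib_prefix (Suc n) = fib_prefix (Suc 0) @ zs"
    using fib_prefix_mono[of "Suc 0" "Suc n"] by auto
  then show ?thesis by (cases x) (auto simp: fib_prefix_Suc fib_prefix_0)
qed

lemma fib_word_infinite: "infinite {i. fib_word !! i = x}"
  unfolding infinite_nat_iff_unbounded
proof
  fix m
  let ?P = "fib_prefix (Suc (Suc m))" and ?Q = "fib_prefix (Suc m)"
  obtain t where t: "fib_word = fib_prefix (Suc (Suc (Suc m))) @- t" using fib_word_prefix by blast
  obtain j where j: "j < length ?Q" "?Q ! j = x"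
    using fib_prefix_letters by (metis in_set_conv_nth)
  have "fib_word = ?P @- (?Q @- t)" using t by (simp add: fib_prefix_rec[of "Suc m"])
  then have "fib_word !! (length ?P + j) = (?P @- (?Q @- t)) !! (length ?P + j)" by (rule arg_cong)
  also have "\<dots> = x" using j by (simp add: shift_snth_ge shift_snth_less)
  finally have "fib_word !! (length ?P + j) = x" .
  moreover have "m < length ?P + j" using fib_prefix_length[of "Suc (Suc m)"] by simp
  ultimately show "\<exists>n>m. n \<in> {i. fib_word !! i = x}" by blast
qed

lemma del_AB_fib_word: "del_AB fib_word = sdrop 2 fib_word"
proof -
  obtain t where t: "fib_word = fib_prefix (Suc 0) @- t" using fib_word_prefix by blast
  have *: "fib_word = A ## B ## t" using t by (simp add: fib_prefix_Suc fib_prefix_0)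
  have "del_first A (A ## B ## t) = B ## t"
    by (simp add: del_first_def Least_eq_0)
  moreover have "del_first B (B ## t) = t"
    by (simp add: del_first_def Least_eq_0)
  ultimately show ?thesis by (simp add: * del_AB_def numeral_2_eq_2)
qed

lemma del_AB_fib_word_infinite: "infinite {i. del_AB fib_word !! i = x}"
  unfolding infinite_nat_iff_unbounded
proof
  fix m
  obtain n where n: "n > m + 2" "fib_word !! n = x"
    using fib_word_infinite[of x] unfolding infinite_nat_iff_unbounded by blast
  have "del_AB fib_word !! (n - 2) = fib_word !! (2 + (n - 2))"
    unfolding del_AB_fib_word by (rule sdrop_snth)
  moreover have "2 + (n - 2) = n" using n by linarith
  ultimately have "del_AB fib_word !! (n - 2) = x" using n by metis
  moreover have "m < n - 2" using n by simp
  ultimately show "\<exists>n>m. n \<in> {i. del_AB fib_word !! i = x}" by blast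
qed

end

theory Submission imports Defs begin

text \<open>The substitution maps every \<open>A\<close> to a block containing exactly one \<open>B\<close>, and \<open>B\<close> to a block
  without \<open>B\<close>. If the \<open>n\<close>-th \<open>A\<close> of the Fibonacci word is at position \<open>k\<close>, its image is therefore the block
  that contains the \<open>n\<close>-th \<open>B\<close>. The \<open>k\<close> letters before it, \<open>n - 1\<close> of which are \<open>A\<close>, have an image
  of length \<open>k + n - 1\<close>, and so the \<open>n\<close>-th \<open>B\<close> is at position \<open>k + n\<close>. Deleting the initial \<open>AB\<close>
  shifts both positions by 2 and both occurrence numbers by 1.\<close>

lemma card_below_enumerate:
  fixes S :: "nat set"
  assumes "infinite S"
  shows "card {j \<in> S. j < enumerate S n} = n"
proof -
  have "{j \<in> S. j < enumerate S n} = enumerate S ` {..<n}"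
  proof (intro equalityI subsetI)
    fix j assume j: "j \<in> {j \<in> S. j < enumerate S n}"
    then obtain m where m: "j = enumerate S m"
      using enumerate_Ex[OF assms] by blast
    with j show "j \<in> enumerate S ` {..<n}"
      using assms by simp
  qed (use assms in \<open>auto simp: enumerate_in_set\<close>)
  moreover have "inj_on (enumerate S) {..<n}"
    using inj_enumerate[OF assms] by (rule inj_on_subset) simp
  ultimately show ?thesis by (simp add: card_image)
qed

text \<open>Every element of \<open>S\<close> is enumerated, and the number of elements below it
  recovers its index.\<close>

lemma enumerate_eq_iff_card_below:
  fixes S :: "nat set"
  assumes "infinite S"
  shows "enumerate S n = k \<longleftrightarrow> k \<in> S \<and> card {j \<in> S. j < k} = n"
  using card_below_enumerate[OF assms] enumerate_in_set[OF assms] enumerate_Ex[OF assms]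
  by metis

lemma count_list_stake: "count_list (stake k w) x = card {j. w !! j = x \<and> j < k}"
proof (induction k)
  case (Suc k)
  have "{j. w !! j = x \<and> j < Suc k} =
      (if w !! k = x then insert k else id) {j. w !! j = x \<and> j < k}"
    by (auto simp: less_Suc_eq)
  then show ?case
    by (simp add: Suc stake_Suc del: stake.simps)
qed simp

text \<open>Reduces a claim about a position to one letter and a count in the prefix before
  it.\<close>

lemma pos_eq_iff:
  assumes "infinite {i. w !! i = x}"
  shows "pos x w (Suc n) = k \<longleftrightarrow> w !! k = x \<and> count_list (stake k w) x = n"
  using enumerate_eq_iff_card_below[OF assms] by (simp add: pos_def count_list_stake)

lemma length_fib_subst: "length (concat (map fib_subst xs)) = length xs + count_list xs A"
proof (induction xs)
  case (Cons x xs)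
  then show ?case by (cases x) simp_all
qed simp

lemma count_B_fib_subst: "count_list (concat (map fib_subst xs)) B = count_list xs A"
proof (induction xs)
  case (Cons x xs)
  then show ?case by (cases x) simp_all
qed simp

lemma fib_word_pos_B: "pos B fib_word (Suc n) = pos A fib_word (Suc n) + Suc n"
proof -
  define k where "k = pos A fib_word (Suc n)"
  define u where "u = concat (map fib_subst (stake k fib_word))"
  have k: "fib_word !! k = A" "count_list (stake k fib_word) A = n"
    using pos_eq_iff[OF fib_word_infinite] k_def by metis+
  have len: "length u = k + n"
    unfolding u_def length_fib_subst using k by simp
  have count: "count_list u B = n"
    unfolding u_def count_B_fib_subst by (rule k)
  have "fib_word = stake (Suc k) fib_word @- sdrop (Suc k) fib_word"
    by (simp only: stake_sdrop)
  then obtain t where "fib_word = stake k fib_word @- [A] @- t"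
    using k(1) by (metis stake_Suc shift_append)
  then have "fib_word = u @- [A, B] @- subst_word fib_subst t"
    using subst_word_fib_shift[of "stake k fib_word @ [A]" t] fib_word_fixed
    by (simp add: u_def)
  \<comment> \<open>Moving \<open>A\<close> into the prefix keeps its number of \<open>B\<close> at
    \<open>n\<close> and exposes the next \<open>B\<close> at index
    \<open>k + Suc n\<close>.\<close>
  then have decomp: "fib_word = (u @ [A]) @- B ## subst_word fib_subst t"
    by simp
  have "fib_word !! (k + Suc n) = B" "stake (k + Suc n) fib_word = u @ [A]"
    by (subst decomp, simp add: len stake_shift shift_snth_ge del: shift_append)+
  then show ?thesis
    unfolding k_def[symmetric] pos_eq_iff[OF fib_word_infinite] using count by simp
qed

lemma pos_del_AB_fib_word: "pos x fib_word (Suc (Suc n)) = pos x (del_AB fib_word) (Suc n) + 2"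
proof -
  define w where "w = del_AB fib_word"
  define k where "k = pos x w (Suc n)"
  have k: "w !! k = x" "count_list (stake k w) x = n"
    using pos_eq_iff[OF del_AB_fib_word_infinite] k_def w_def by metis+
  obtain t where t: "fib_word = A ## B ## t"
    using fib_word_prefix[of 1] by (auto simp: fib_prefix_Suc fib_prefix_0)
  have "w = t"
    unfolding w_def del_AB_fib_word by (simp add: t numeral_2_eq_2)
  with t have eq: "fib_word = A ## B ## w" by simp
  have "fib_word !! (k + 2) = w !! k" "stake (k + 2) fib_word = A # B # stake k w"
    by (simp_all add: eq)
  \<comment> \<open>The initial \<open>A\<close> and \<open>B\<close> add exactly one occurrence of
    \<open>x\<close>, whichever letter it is.\<close>
  then have "fib_word !! (k + 2) = x" "count_list (stake (k + 2) fib_word) x = Suc n"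
    using k by (simp_all only:) (cases x; simp)
  then show ?thesis
    unfolding w_def[symmetric] k_def[symmetric] pos_eq_iff[OF fib_word_infinite] by blast
qed

theorem theorem4p7:
  fixes w :: "letter stream"
  assumes "w = del_AB fib_word"
  shows "\<forall>n::nat\<ge>1. pos_diff w n = int n + 1"
proof (intro allI impI)
  fix n :: nat
  assume "1 \<le> n"
  then obtain m where "n = Suc m" by (cases n) auto
  then show "pos_diff w n = int n + 1"
    \<comment> \<open>The shifts by 2 cancel; the occurrence number in \<open>fib_word\<close> is
      \<open>Suc (Suc m)\<close>, that is \<open>n + 1\<close>.\<close>
    using fib_word_pos_B[of "Suc m"] pos_del_AB_fib_word[of A m] pos_del_AB_fib_word[of B m]
    by (simp add: pos_diff_def assms)
qed

end
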